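(* A block $\Pi$ is refutable in $\mathsf{BT}^{i}$ if and only if it is not realizable; and if it is realizable, it is realized in a finite Kripke model with at most $4^{|\mathrm{Sub}(\Pi)|}$ worlds.
   Context: Formulae are generated from a countable set $\mathit{Var}$ of propositional variables by $A ::= p \mid \bot \mid A\land A \mid A\lor A \mid A\to A$. A Kripke model is $\mathcal M=(W,\le,V)$ with $W$ non-empty, $\le$ a preorder on $W$, and $V\colon W\to\mathcal P(\mathit{Var})$ monotone ($w\le v$ implies $V(w)\subseteq V(v)$). Forcing: $w\Vdash p$ iff $p\in V(w)$; never $w\Vdash\bot$; $w\Vdash A\land B$ iff $w\Vdash A$ and $w\Vdash B$; $w\Vdash A\lor B$ iff $w\Vdash A$ or $w\Vdash B$; $w\Vdash A\to B$ iff for every $v\ge w$, $v\Vdash A$ implies $v\Vdash B$. Blocks. A signed formula is $\mathsf{T}A$ or $\mathsf{F}A$; a block is a finite set $\Pi$ of signed formulae; $\Pi^{\mathsf{T}}=\{\mathsf{T}A:\mathsf{T}A\in\Pi\}$. $\mathrm{Sub}(\Pi)$ is the set of all subformulae of formulae $A$ such that $\mathsf{T}A\in\Pi$ or $\mathsf{F}A\in\Pi$. A block $\Pi$ is realized at a world $w$ of a Kripke model if $w\Vdash A$ for every $\mathsf{T}A\in\Pi$ and $w\nVdash B$ for every $\mathsf{F}B\in\Pi$; it is realizable if it is realized at some world of some model. The calculus $\mathsf{BT}^{i}$. A block is closed if it contains $\mathsf{T}p$ and $\mathsf{F}p$ for some propositional variable $p$, or contains $\mathsf{T}\bot$. The rules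 pass from a block (context $\Pi$ plus displayed principal formula, which is removed unless displayed again) to one or two children: - $\mathsf{T}\land$: from $\Pi,\mathsf{T}(A\land B)$ to $\Pi,\mathsf{T}A,\mathsf{T}B$. - $\mathsf{F}\lor$: from $\Pi,\mathsf{F}(A\lor B)$ to $\Pi,\mathsf{F}A,\mathsf{F}B$. - $\mathsf{T}\lor$: from $\Pi,\mathsf{T}(A\lor B)$ to two children $\Pi,\mathsf{T}A$ and $\Pi,\mathsf{T}B$. - $\mathsf{F}\land$: from $\Pi,\mathsf{F}(A\land B)$ to two children $\Pi,\mathsf{F}A$ and $\Pi,\mathsf{F}B$. - $\mathsf{T}\to$: from $\Pi,\mathsf{T}(A\to B)$ to two children $\Pi,\mathsf{T}(A\to B),\mathsf{F}A$ and $\Pi,\mathsf{T}B$. - $\mathsf{F}\to$: from $\Pi,\mathsf{F}(A\to B)$ to $\Pi^{\mathsf{T}},\mathsf{T}A,\mathsf{F}B$. A tableau for $\Pi$ is a finite tree rooted at $\Pi$ grown by these rules; it is closed if every leaf is a closed block. $\Pi$ is refutable if it has a closed tableau. *)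

theory Defs
  imports Main "HOL-Library.Countable" "HOL-Library.Infinite_Typeclass"
begin

datatype 'v fm =
    Atom 'v
  | Falsum
  | Conj "'v fm" "'v fm"
  | Disj "'v fm" "'v fm"
  | Impl "'v fm" "'v fm"

primrec subformulae :: "'v fm \<Rightarrow> 'v fm set" where
  "subformulae (Atom p) = {Atom p}"
| "subformulae Falsum = {Falsum}"
| "subformulae (Conj A B) = {Conj A B} \<union> subformulae A \<union> subformulae B"
| "subformulae (Disj A B) = {Disj A B} \<union> subformulae A \<union> subformulae B"
| "subformulae (Impl A B) = {Impl A B} \<union> subformulae A \<union> subformulae B"

record ('w, 'v) kripke =
  worlds :: "'w set"
  acc :: "('w \<times> 'w) set"
  val :: "'w \<Rightarrow> 'v set"

definition kripke_model :: "('w, 'v) kripke \<Rightarrow> bool" where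
  "kripke_model M \<longleftrightarrow>
     worlds M \<noteq> {} \<and> preorder_on (worlds M) (acc M) \<and>
     (\<forall>w\<in>worlds M. \<forall>v\<in>worlds M. (w, v) \<in> acc M \<longrightarrow> val M w \<subseteq> val M v)"

primrec forces :: "('w, 'v) kripke \<Rightarrow> 'w \<Rightarrow> 'v fm \<Rightarrow> bool" where
  "forces M w (Atom p) \<longleftrightarrow> p \<in> val M w"
| "forces M w Falsum \<longleftrightarrow> False"
| "forces M w (Conj A B) \<longleftrightarrow> forces M w A \<and> forces M w B"
| "forces M w (Disj A B) \<longleftrightarrow> forces M w A \<or> forces M w B"
| "forces M w (Impl A B) \<longleftrightarrow>
     (\<forall>v\<in>worlds M. (w, v) \<in> acc M \<longrightarrow> forces M v A \<longrightarrow> forces M v B)"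

datatype 'v signed = T "'v fm" | F "'v fm"

text \<open>Blocks are finite; finiteness is assumed where blocks are quantified over,
  and is preserved by the rules.\<close>

type_synonym 'v block = "'v signed set"

definition T_part :: "'v block \<Rightarrow> 'v block" where
  "T_part \<Pi> = {T A | A. T A \<in> \<Pi>}"

definition Sub :: "'v block \<Rightarrow> 'v fm set" where
  "Sub \<Pi> = (\<Union>A\<in>{A. T A \<in> \<Pi> \<or> F A \<in> \<Pi>}. subformulae A)"

definition realized_at :: "('w, 'v) kripke \<Rightarrow> 'w \<Rightarrow> 'v block \<Rightarrow> bool" where
  "realized_at M w \<Pi> \<longleftrightarrow>
     (\<forall>A. T A \<in> \<Pi> \<longrightarrow> forces M w A) \<and> (\<forall>B. F B \<in> \<Pi> \<longrightarrow> \<not> forces M w B)"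

text \<open>A definition cannot quantify over all types of worlds, so realizability is relative
  to the type \<open>'w\<close> from which the worlds are drawn (a model may use any non-empty subset).\<close>

definition realizable :: "'w itself \<Rightarrow> 'v block \<Rightarrow> bool" where
  "realizable TYPE('w) \<Pi> \<longleftrightarrow>
     (\<exists>(M :: ('w, 'v) kripke) w. kripke_model M \<and> w \<in> worlds M \<and> realized_at M w \<Pi>)"

definition closed_block :: "'v block \<Rightarrow> bool" where
  "closed_block \<Pi> \<longleftrightarrow> (\<exists>p. T (Atom p) \<in> \<Pi> \<and> F (Atom p) \<in> \<Pi>) \<or> T Falsum \<in> \<Pi>"

text \<open>\<open>expand \<Gamma> \<Delta>s\<close>: some rule passes from the block \<open>\<Gamma>\<close> to the list \<open>\<Delta>s\<close> of children. The side
  conditions say that the context does not contain the principal formula, so that the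
  principal formula is really removed unless it is displayed again.\<close>

inductive expand :: "'v block \<Rightarrow> 'v block list \<Rightarrow> bool" where
  T_Conj: "T (Conj A B) \<notin> \<Pi> \<Longrightarrow>
    expand (\<Pi> \<union> {T (Conj A B)}) [\<Pi> \<union> {T A, T B}]"
| F_Disj: "F (Disj A B) \<notin> \<Pi> \<Longrightarrow>
    expand (\<Pi> \<union> {F (Disj A B)}) [\<Pi> \<union> {F A, F B}]"
| T_Disj: "T (Disj A B) \<notin> \<Pi> \<Longrightarrow>
    expand (\<Pi> \<union> {T (Disj A B)}) [\<Pi> \<union> {T A}, \<Pi> \<union> {T B}]"
| F_Conj: "F (Conj A B) \<notin> \<Pi> \<Longrightarrow>
    expand (\<Pi> \<union> {F (Conj A B)}) [\<Pi> \<union> {F A}, \<Pi> \<union> {F B}]"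
| T_Impl: "T (Impl A B) \<notin> \<Pi> \<Longrightarrow>
    expand (\<Pi> \<union> {T (Impl A B)}) [\<Pi> \<union> {T (Impl A B), F A}, \<Pi> \<union> {T B}]"
| F_Impl: "F (Impl A B) \<notin> \<Pi> \<Longrightarrow>
    expand (\<Pi> \<union> {F (Impl A B)}) [T_part \<Pi> \<union> {T A, F B}]"

datatype 'v tree = Node (root: "'v block") (children: "'v tree list")

inductive tableau :: "'v tree \<Rightarrow> bool" where
  leaf: "tableau (Node \<Pi> [])"
| grow: "expand \<Pi> (map root ts) \<Longrightarrow> (\<forall>t\<in>set ts. tableau t) \<Longrightarrow> tableau (Node \<Pi> ts)"

primrec leaves :: "'v tree \<Rightarrow> 'v block set" where
  "leaves (Node \<Pi> ts) = (if ts = [] then {\<Pi>} else \<Union> (set (map leaves ts)))"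

definition closed_tableau :: "'v tree \<Rightarrow> bool" where
  "closed_tableau t \<longleftrightarrow> tableau t \<and> (\<forall>\<Pi>\<in>leaves t. closed_block \<Pi>)"

definition refutable :: "'v block \<Rightarrow> bool" where
  "refutable \<Pi> \<longleftrightarrow> (\<exists>t. closed_tableau t \<and> root t = \<Pi>)"

end

theory Submission imports Defs begin

text \<open>
  Soundness: each rule passes from a block realized in a model to blocks of which at least one is
  realized in the same model, possibly at a later world in the case of \<open>F_Impl\<close>. So the root of a
  closed tableau is not realized anywhere, whatever the type of worlds.

  Completeness and the bound come from one finite model. Its worlds are the maximal non-refutable
  sets of signed subformulae of the given block, ordered by inclusion of their \<open>T\<close>-parts. There
  are at most \<open>2 ^ (2 * n) = 4 ^ n\<close> of these when there are \<open>n\<close> subformulae. Maximality should make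
  every world a Hintikka set, so that a world realizes itself.

  The obstacle is that a rule discards its principal formula, whereas maximality only speaks about
  supersets: that \<open>T (Conj A B)\<close> belongs to a world \<open>\<Gamma>\<close> gives \<open>T A, T B \<in> \<Gamma>\<close> only if refutability of
  \<open>\<Gamma> \<union> {T A, T B}\<close>, with the principal formula still there, implies refutability of \<open>\<Gamma>\<close>. So it has
  to be shown that a formula whose components are present is redundant. This is
  \<open>refutable_absorb\<close>: closing a block under the inverses of the rules other than \<open>F_Impl\<close> (for
  \<open>T_Impl\<close>, of its second child, the one that lacks the principal formula) does not turn
  a non-refutable block into a refutable one. It contains weakening as a
  special case, and it yields the cumulative form of the rules from which the Hintikka conditions are immediate.
\<close>

section \<open>Refutability as an inductive predicate\<close>

lemma refutable_closed:
  assumes "closed_block \<Gamma>"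
  shows "refutable \<Gamma>"
  unfolding refutable_def closed_tableau_def
  using assms by (intro exI[of _ "Node \<Gamma> []"]) (auto intro: tableau.leaf)

lemma refutable_expand:
  assumes "expand \<Gamma> \<Delta>s" and "\<forall>\<Delta>\<in>set \<Delta>s. refutable \<Delta>"
  shows "refutable \<Gamma>"
proof -
  obtain f where f: "\<forall>\<Delta>\<in>set \<Delta>s. closed_tableau (f \<Delta>) \<and> root (f \<Delta>) = \<Delta>"
    using assms(2) unfolding refutable_def by metis
  have "map root (map f \<Delta>s) = \<Delta>s"
    using f by (simp add: map_idI)
  then have "tableau (Node \<Gamma> (map f \<Delta>s))"
    using assms(1) f by (intro tableau.grow) (auto simp: closed_tableau_def)
  \<comment> \<open>Without children the new tree would be a leaf, which need not be closed.\<close>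
  moreover have "\<Delta>s \<noteq> []"
    using assms(1) by (auto elim: expand.cases)
  ultimately have "closed_tableau (Node \<Gamma> (map f \<Delta>s))"
    using f by (auto simp: closed_tableau_def)
  then show ?thesis
    unfolding refutable_def by (intro exI[of _ "Node \<Gamma> (map f \<Delta>s)"]) simp
qed

lemma refutable_induct [consumes 1, case_names closed expand]:
  assumes "refutable \<Gamma>"
    and closed: "\<And>\<Gamma>. closed_block \<Gamma> \<Longrightarrow> P \<Gamma>"
    and expand: "\<And>\<Gamma> \<Delta>s. expand \<Gamma> \<Delta>s \<Longrightarrow> \<forall>\<Delta>\<in>set \<Delta>s. P \<Delta> \<Longrightarrow> P \<Gamma>"
  shows "P \<Gamma>"
proof -
  have "closed_tableau t \<Longrightarrow> P (root t)" for t
  proof (induction t)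
    case (Node \<Gamma> ts)
    show ?case
    proof (cases "ts = []")
      case True
      then show ?thesis
        using Node.prems closed by (simp add: closed_tableau_def)
    next
      case False
      then have "expand \<Gamma> (map root ts)" and "\<forall>t\<in>set ts. tableau t"
        using Node.prems by (auto simp: closed_tableau_def elim: tableau.cases)
      moreover from this have "\<forall>t\<in>set ts. P (root t)"
        using Node False by (auto simp: closed_tableau_def)
      ultimately show ?thesis
        using expand[of \<Gamma> "map root ts"] by simp
    qed
  qed
  then show ?thesis
    using assms(1) unfolding refutable_def by blast
qed

section \<open>Soundness\<close>

lemma forces_mono:
  assumes "kripke_model M" "w \<in> worlds M" "v \<in> worlds M" "(w, v) \<in> acc M" "forces M w A"
  shows "forces M v A"
  using assms
proof (induction A)
  case (Impl A B)
  have "trans (acc M)"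
    using Impl.prems(1) by (simp add: kripke_model_def preorder_on_def)
  then show ?case
    using Impl.prems by (auto dest: transD)
qed (auto simp: kripke_model_def)

lemma realized_at_insert:
  shows realized_at_insert_T: "realized_at M w (insert (T A) \<Gamma>) \<longleftrightarrow>
      forces M w A \<and> realized_at M w \<Gamma>"
    and realized_at_insert_F: "realized_at M w (insert (F A) \<Gamma>) \<longleftrightarrow>
      \<not> forces M w A \<and> realized_at M w \<Gamma>"
  by (auto simp: realized_at_def)

lemma realized_at_T_part:
  assumes "kripke_model M" "w \<in> worlds M" "v \<in> worlds M" "(w, v) \<in> acc M" "realized_at M w \<Gamma>"
  shows "realized_at M v (T_part \<Gamma>)"
  using forces_mono[OF assms(1-4)] assms(5) by (auto simp: realized_at_def T_part_def)

lemma realized_at_expand: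
  assumes M: "kripke_model M" "w \<in> worlds M"
    and "expand \<Gamma> \<Delta>s" "realized_at M w \<Gamma>"
  shows "\<exists>\<Delta>\<in>set \<Delta>s. \<exists>v\<in>worlds M. realized_at M v \<Delta>"
proof -
  have here: ?thesis if "\<exists>\<Delta>\<in>set \<Delta>s. realized_at M w \<Delta>"
    using that M(2) by blast
  from assms(3) show ?thesis
  proof cases
    case (T_Impl A B \<Pi>)
    have "(w, w) \<in> acc M"
      using M by (auto simp: kripke_model_def preorder_on_def refl_on_def)
    then have "\<exists>\<Delta>\<in>set \<Delta>s. realized_at M w \<Delta>"
      using T_Impl M(2) assms(4) by (auto simp: realized_at_insert)
    then show ?thesis
      by (rule here)
  next
    case (F_Impl A B \<Pi>)
    then obtain v where v: "v \<in> worlds M" "(w, v) \<in> acc M" "forces M v A" "\<not> forces M v B"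
      using assms(4) by (auto simp: realized_at_insert)
    moreover have "realized_at M v (T_part \<Pi>)"
      using F_Impl assms(4) realized_at_T_part[OF M v(1,2)] by (simp add: realized_at_insert)
    ultimately have "realized_at M v (T_part \<Pi> \<union> {T A, F B})"
      by (simp add: realized_at_insert)
    then show ?thesis
      using F_Impl(2) v(1) by (metis list.set_intros(1))
  qed ((rule here, (use assms(4) in \<open>auto simp: realized_at_insert\<close>)[1])+)
qed

lemma closed_block_not_realized_at: "closed_block \<Gamma> \<Longrightarrow> \<not> realized_at M w \<Gamma>"
  unfolding closed_block_def realized_at_def by (metis forces.simps(2))

lemma refutable_not_realized_at:
  assumes "refutable \<Gamma>" "kripke_model M" "w \<in> worlds M"
  shows "\<not> realized_at M w \<Gamma>"
proof -
  have "\<forall>w\<in>worlds M. \<not> realized_at M w \<Gamma>"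
    using assms(1)
  proof (induction rule: refutable_induct)
    case (closed \<Gamma>)
    then show ?case
      by (simp add: closed_block_not_realized_at)
  next
    case (expand \<Gamma> \<Delta>s)
    then show ?case
      using realized_at_expand[OF assms(2)] by meson
  qed
  then show ?thesis
    using assms(3) by blast
qed

corollary refutable_not_realizable: "refutable \<Gamma> \<Longrightarrow> \<not> realizable TYPE('w) \<Gamma>"
  by (auto simp: realizable_def dest: refutable_not_realized_at)

section \<open>Redundant formulae and cumulative rules\<close>

text \<open>
  Signed formulae whose realization at a world follows, by way of their components, from that of
  \<open>\<Gamma>\<close> at the same world. There is no clause for \<open>F (Impl A B)\<close>, whose
  components speak about another world, and none that derives \<open>T (Impl A B)\<close> from \<open>F A\<close>: truth of
  an implication has to persist, falsity of \<open>A\<close> does not. As a consequence the \<open>T\<close>-formulae obtained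
  depend only on the \<open>T\<close>-part of \<open>\<Gamma>\<close>.
\<close>

inductive_set absorbed :: "'v block \<Rightarrow> 'v block" for \<Gamma> where
  base: "\<phi> \<in> \<Gamma> \<Longrightarrow> \<phi> \<in> absorbed \<Gamma>"
| T_Conj: "T A \<in> absorbed \<Gamma> \<Longrightarrow> T B \<in> absorbed \<Gamma> \<Longrightarrow> T (Conj A B) \<in> absorbed \<Gamma>"
| F_Disj: "F A \<in> absorbed \<Gamma> \<Longrightarrow> F B \<in> absorbed \<Gamma> \<Longrightarrow> F (Disj A B) \<in> absorbed \<Gamma>"
| T_Disj: "T A \<in> absorbed \<Gamma> \<or> T B \<in> absorbed \<Gamma> \<Longrightarrow> T (Disj A B) \<in> absorbed \<Gamma>"
| F_Conj: "F A \<in> absorbed \<Gamma> \<or> F B \<in> absorbed \<Gamma> \<Longrightarrow> F (Conj A B) \<in> absorbed \<Gamma>"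
| T_Impl: "T B \<in> absorbed \<Gamma> \<Longrightarrow> T (Impl A B) \<in> absorbed \<Gamma>"

lemma absorbed_least:
  assumes "\<Gamma> \<subseteq> absorbed \<Delta>"
  shows "absorbed \<Gamma> \<subseteq> absorbed \<Delta>"
proof
  fix \<phi> assume "\<phi> \<in> absorbed \<Gamma>"
  then show "\<phi> \<in> absorbed \<Delta>"
    by induction (use assms in \<open>auto intro: absorbed.intros\<close>)
qed

lemma absorbed_subset_remove:
  assumes "\<phi> \<in> absorbed (\<Gamma> - {\<phi>} \<union> C)"
  shows "absorbed \<Gamma> \<subseteq> absorbed (\<Gamma> - {\<phi>} \<union> C)"
proof (rule absorbed_least, rule subsetI)
  fix \<psi> assume "\<psi> \<in> \<Gamma>"
  then show "\<psi> \<in> absorbed (\<Gamma> - {\<phi>} \<union> C)"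
    using assms by (cases "\<psi> = \<phi>") (simp_all add: absorbed.base)
qed

lemma absorbed_T_part:
  assumes "T A \<in> absorbed \<Gamma>"
  shows "T A \<in> absorbed (T_part \<Gamma>)"
proof -
  have "\<phi> = T A \<longrightarrow> T A \<in> absorbed (T_part \<Gamma>)" if "\<phi> \<in> absorbed \<Gamma>" for \<phi> and A
    using that
    by (induction arbitrary: A) (auto intro: absorbed.intros simp: T_part_def)
  then show ?thesis
    using assms by blast
qed

lemma absorbed_iff:
  shows "T (Atom p) \<in> absorbed \<Gamma> \<longleftrightarrow> T (Atom p) \<in> \<Gamma>"
    and "F (Atom p) \<in> absorbed \<Gamma> \<longleftrightarrow> F (Atom p) \<in> \<Gamma>"
    and "T Falsum \<in> absorbed \<Gamma> \<longleftrightarrow> T Falsum \<in> \<Gamma>"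
    and "T (Conj A B) \<in> absorbed \<Gamma> \<longleftrightarrow>
      T (Conj A B) \<in> \<Gamma> \<or> (T A \<in> absorbed \<Gamma> \<and> T B \<in> absorbed \<Gamma>)"
    and "F (Disj A B) \<in> absorbed \<Gamma> \<longleftrightarrow>
      F (Disj A B) \<in> \<Gamma> \<or> (F A \<in> absorbed \<Gamma> \<and> F B \<in> absorbed \<Gamma>)"
    and "T (Disj A B) \<in> absorbed \<Gamma> \<longleftrightarrow>
      T (Disj A B) \<in> \<Gamma> \<or> (T A \<in> absorbed \<Gamma> \<or> T B \<in> absorbed \<Gamma>)"
    and "F (Conj A B) \<in> absorbed \<Gamma> \<longleftrightarrow>
      F (Conj A B) \<in> \<Gamma> \<or> (F A \<in> absorbed \<Gamma> \<or> F B \<in> absorbed \<Gamma>)"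
    and "T (Impl A B) \<in> absorbed \<Gamma> \<longleftrightarrow> T (Impl A B) \<in> \<Gamma> \<or> T B \<in> absorbed \<Gamma>"
    and "F (Impl A B) \<in> absorbed \<Gamma> \<longleftrightarrow> F (Impl A B) \<in> \<Gamma>"
  by (subst absorbed.simps, simp)+

text \<open>The rules in the form in which they are applied to a block that is known to contain the
  principal formula.\<close>

lemma refutable_rules:
  shows refutable_T_Conj: "T (Conj A B) \<in> \<Gamma> \<Longrightarrow>
      refutable (\<Gamma> - {T (Conj A B)} \<union> {T A, T B}) \<Longrightarrow> refutable \<Gamma>"
    and refutable_F_Disj: "F (Disj A B) \<in> \<Gamma> \<Longrightarrow>
      refutable (\<Gamma> - {F (Disj A B)} \<union> {F A, F B}) \<Longrightarrow> refutable \<Gamma>"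
    and refutable_T_Disj: "T (Disj A B) \<in> \<Gamma> \<Longrightarrow>
      refutable (\<Gamma> - {T (Disj A B)} \<union> {T A}) \<Longrightarrow>
      refutable (\<Gamma> - {T (Disj A B)} \<union> {T B}) \<Longrightarrow> refutable \<Gamma>"
    and refutable_F_Conj: "F (Conj A B) \<in> \<Gamma> \<Longrightarrow>
      refutable (\<Gamma> - {F (Conj A B)} \<union> {F A}) \<Longrightarrow>
      refutable (\<Gamma> - {F (Conj A B)} \<union> {F B}) \<Longrightarrow> refutable \<Gamma>"
    and refutable_T_Impl: "T (Impl A B) \<in> \<Gamma> \<Longrightarrow>
      refutable (\<Gamma> \<union> {F A}) \<Longrightarrow>
      refutable (\<Gamma> - {T (Impl A B)} \<union> {T B}) \<Longrightarrow> refutable \<Gamma>"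
    and refutable_F_Impl: "F (Impl A B) \<in> \<Gamma> \<Longrightarrow>
      refutable (T_part \<Gamma> \<union> {T A, F B}) \<Longrightarrow> refutable \<Gamma>"
proof -
  have split: "\<Gamma> - {\<phi>} \<union> {\<phi>} = \<Gamma>" if "\<phi> \<in> \<Gamma>" for \<phi>
    using that by auto
  show "refutable \<Gamma>" if "T (Conj A B) \<in> \<Gamma>" "refutable (\<Gamma> - {T (Conj A B)} \<union> {T A, T B})"
    using refutable_expand[OF expand.T_Conj[of A B "\<Gamma> - {T (Conj A B)}"]] that
    by (simp only: split) simp
  show "refutable \<Gamma>" if "F (Disj A B) \<in> \<Gamma>" "refutable (\<Gamma> - {F (Disj A B)} \<union> {F A, F B})"
    using refutable_expand[OF expand.F_Disj[of A B "\<Gamma> - {F (Disj A B)}"]] that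
    by (simp only: split) simp
  show "refutable \<Gamma>" if "T (Disj A B) \<in> \<Gamma>" "refutable (\<Gamma> - {T (Disj A B)} \<union> {T A})"
    "refutable (\<Gamma> - {T (Disj A B)} \<union> {T B})"
    using refutable_expand[OF expand.T_Disj[of A B "\<Gamma> - {T (Disj A B)}"]] that
    by (simp only: split) simp
  show "refutable \<Gamma>" if "F (Conj A B) \<in> \<Gamma>" "refutable (\<Gamma> - {F (Conj A B)} \<union> {F A})"
    "refutable (\<Gamma> - {F (Conj A B)} \<union> {F B})"
    using refutable_expand[OF expand.F_Conj[of A B "\<Gamma> - {F (Conj A B)}"]] that
    by (simp only: split) simp
  show "refutable \<Gamma>" if "T (Impl A B) \<in> \<Gamma>" "refutable (\<Gamma> \<union> {F A})"
    "refutable (\<Gamma> - {T (Impl A B)} \<union> {T B})"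
  proof -
    have "\<Gamma> - {T (Impl A B)} \<union> {T (Impl A B), F A} = \<Gamma> \<union> {F A}"
      using that(1) by auto
    then show ?thesis
      using refutable_expand[OF expand.T_Impl[of A B "\<Gamma> - {T (Impl A B)}"]] that
      by (simp only: split) simp
  qed
  show "refutable \<Gamma>" if "F (Impl A B) \<in> \<Gamma>" "refutable (T_part \<Gamma> \<union> {T A, F B})"
  proof -
    have "T_part (\<Gamma> - {F (Impl A B)}) = T_part \<Gamma>"
      by (auto simp: T_part_def)
    then show ?thesis
      using refutable_expand[OF expand.F_Impl[of A B "\<Gamma> - {F (Impl A B)}"]] that
      by (simp only: split) simp
  qed
qed

text \<open>
  A refutation of \<open>\<Gamma>\<close> is replayed on \<open>\<Delta>\<close>. A step whose principal formula is in \<open>\<Delta>\<close> is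
  copied; a principal formula that this removes from \<open>\<Delta>\<close> is absorbed by the children. A step whose
  principal formula is merely absorbed is skipped: the components that put it there are those of one
  of the children, so that child is still contained in \<open>absorbed \<Delta>\<close>. For \<open>F_Impl\<close> only the first
  case arises, and the inclusion survives the loss of the \<open>F\<close>-formulae by \<open>absorbed_T_part\<close>.
\<close>

lemma refutable_absorb:
  assumes "refutable \<Gamma>" "\<Gamma> \<subseteq> absorbed \<Delta>"
  shows "refutable \<Delta>"
  using assms
proof (induction arbitrary: \<Delta> rule: refutable_induct)
  case (closed \<Gamma>)
  then have "(\<exists>p. T (Atom p) \<in> absorbed \<Delta> \<and> F (Atom p) \<in> absorbed \<Delta>) \<or> T Falsum \<in> absorbed \<Delta>"
    unfolding closed_block_def by blast
  then have "closed_block \<Delta>"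
    by (simp add: closed_block_def absorbed_iff)
  then show ?case
    by (rule refutable_closed)
next
  case (expand \<Gamma> \<Delta>s)
  have IH: "refutable \<Delta>'" if "\<Gamma>' \<in> set \<Delta>s" "\<Gamma>' \<subseteq> absorbed \<Delta>'" for \<Gamma>' \<Delta>'
    using expand.IH that by blast
  have copy: "refutable (\<Delta> - {\<phi>} \<union> C)"
    if "\<Gamma>' \<in> set \<Delta>s" "\<Gamma>' \<subseteq> \<Gamma> \<union> C" "\<phi> \<in> absorbed (\<Delta> - {\<phi>} \<union> C)" for \<phi> \<Gamma>' C
  proof (rule IH[OF that(1)])
    have "C \<subseteq> absorbed (\<Delta> - {\<phi>} \<union> C)"
      by (simp add: subset_iff absorbed.base)
    then show "\<Gamma>' \<subseteq> absorbed (\<Delta> - {\<phi>} \<union> C)"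
      using that(2) expand.prems absorbed_subset_remove[OF that(3)] by blast
  qed
  from \<open>expand \<Gamma> \<Delta>s\<close> show ?case
  proof cases
    case (T_Conj A B \<Pi>)
    then have "T (Conj A B) \<in> absorbed \<Delta>"
      using expand.prems by auto
    then consider "T (Conj A B) \<in> \<Delta>" | "T A \<in> absorbed \<Delta>" "T B \<in> absorbed \<Delta>"
      by (auto simp: absorbed_iff)
    then show ?thesis
    proof cases
      case 1
      have "refutable (\<Delta> - {T (Conj A B)} \<union> {T A, T B})"
        by (rule copy[of "\<Pi> \<union> {T A, T B}"]) (use T_Conj in \<open>auto simp: absorbed.intros\<close>)
      then show ?thesis
        by (rule refutable_T_Conj[OF 1])
    next
      case 2
      then show ?thesis
        using IH[of "\<Pi> \<union> {T A, T B}"] T_Conj expand.prems by auto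
    qed
  next
    case (F_Disj A B \<Pi>)
    then have "F (Disj A B) \<in> absorbed \<Delta>"
      using expand.prems by auto
    then consider "F (Disj A B) \<in> \<Delta>" | "F A \<in> absorbed \<Delta>" "F B \<in> absorbed \<Delta>"
      by (auto simp: absorbed_iff)
    then show ?thesis
    proof cases
      case 1
      have "refutable (\<Delta> - {F (Disj A B)} \<union> {F A, F B})"
        by (rule copy[of "\<Pi> \<union> {F A, F B}"]) (use F_Disj in \<open>auto simp: absorbed.intros\<close>)
      then show ?thesis
        by (rule refutable_F_Disj[OF 1])
    next
      case 2
      then show ?thesis
        using IH[of "\<Pi> \<union> {F A, F B}"] F_Disj expand.prems by auto
    qed
  next
    case (T_Disj A B \<Pi>)
    then have "T (Disj A B) \<in> absorbed \<Delta>"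
      using expand.prems by auto
    then consider "T (Disj A B) \<in> \<Delta>" | "T A \<in> absorbed \<Delta> \<or> T B \<in> absorbed \<Delta>"
      by (auto simp: absorbed_iff)
    then show ?thesis
    proof cases
      case 1
      have "refutable (\<Delta> - {T (Disj A B)} \<union> {T A})"
        by (rule copy[of "\<Pi> \<union> {T A}"]) (use T_Disj in \<open>auto simp: absorbed.intros\<close>)
      moreover have "refutable (\<Delta> - {T (Disj A B)} \<union> {T B})"
        by (rule copy[of "\<Pi> \<union> {T B}"]) (use T_Disj in \<open>auto simp: absorbed.intros\<close>)
      ultimately show ?thesis
        by (rule refutable_T_Disj[OF 1])
    next
      case 2
      then show ?thesis
        using IH[of "\<Pi> \<union> {T A}"] IH[of "\<Pi> \<union> {T B}"] T_Disj expand.prems by auto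
    qed
  next
    case (F_Conj A B \<Pi>)
    then have "F (Conj A B) \<in> absorbed \<Delta>"
      using expand.prems by auto
    then consider "F (Conj A B) \<in> \<Delta>" | "F A \<in> absorbed \<Delta> \<or> F B \<in> absorbed \<Delta>"
      by (auto simp: absorbed_iff)
    then show ?thesis
    proof cases
      case 1
      have "refutable (\<Delta> - {F (Conj A B)} \<union> {F A})"
        by (rule copy[of "\<Pi> \<union> {F A}"]) (use F_Conj in \<open>auto simp: absorbed.intros\<close>)
      moreover have "refutable (\<Delta> - {F (Conj A B)} \<union> {F B})"
        by (rule copy[of "\<Pi> \<union> {F B}"]) (use F_Conj in \<open>auto simp: absorbed.intros\<close>)
      ultimately show ?thesis
        by (rule refutable_F_Conj[OF 1])
    next
      case 2
      then show ?thesis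
        using IH[of "\<Pi> \<union> {F A}"] IH[of "\<Pi> \<union> {F B}"] F_Conj expand.prems by auto
    qed
  next
    case (T_Impl A B \<Pi>)
    then have "T (Impl A B) \<in> absorbed \<Delta>"
      using expand.prems by auto
    then consider "T (Impl A B) \<in> \<Delta>" | "T B \<in> absorbed \<Delta>"
      by (auto simp: absorbed_iff)
    then show ?thesis
    proof cases
      case 1
      have "absorbed \<Delta> \<subseteq> absorbed (\<Delta> \<union> {F A})"
        by (rule absorbed_least) (simp add: subset_iff absorbed.base)
      then have "refutable (\<Delta> \<union> {F A})"
        by (intro IH[of "\<Pi> \<union> {T (Impl A B), F A}"])
          (use T_Impl expand.prems in \<open>auto simp: absorbed.base\<close>)
      moreover have "refutable (\<Delta> - {T (Impl A B)} \<union> {T B})"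
        by (rule copy[of "\<Pi> \<union> {T B}"]) (use T_Impl in \<open>auto simp: absorbed.intros\<close>)
      ultimately show ?thesis
        by (rule refutable_T_Impl[OF 1])
    next
      case 2
      then show ?thesis
        using IH[of "\<Pi> \<union> {T B}"] T_Impl expand.prems by auto
    qed
  next
    case (F_Impl A B \<Pi>)
    then have "F (Impl A B) \<in> absorbed \<Delta>"
      using expand.prems by auto
    then have 1: "F (Impl A B) \<in> \<Delta>"
      by (simp add: absorbed_iff)
    have "T_part \<Pi> \<subseteq> absorbed (T_part \<Delta>)"
      using F_Impl expand.prems by (auto simp: T_part_def[of \<Pi>] intro: absorbed_T_part)
    also have "\<dots> \<subseteq> absorbed (T_part \<Delta> \<union> {T A, F B})"
      by (rule absorbed_least) (simp add: subset_iff absorbed.base)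
    finally have "refutable (T_part \<Delta> \<union> {T A, F B})"
      by (intro IH[of "T_part \<Pi> \<union> {T A, F B}"])
        (use F_Impl in \<open>auto intro: absorbed.base\<close>)
    with 1 show ?thesis
      by (rule refutable_F_Impl)
  qed
qed

text \<open>The children may keep the principal formula: by \<open>refutable_absorb\<close> it can be dropped from a
  refutable block that contains its components. Their being supersets of \<open>\<Gamma>\<close> is what allows
  maximality to be applied to them.\<close>

lemma refutable_cumulative:
  shows refutable_T_Conj_cumulative: "T (Conj A B) \<in> \<Gamma> \<Longrightarrow>
      refutable (\<Gamma> \<union> {T A, T B}) \<Longrightarrow> refutable \<Gamma>"
    and refutable_F_Disj_cumulative: "F (Disj A B) \<in> \<Gamma> \<Longrightarrow>
      refutable (\<Gamma> \<union> {F A, F B}) \<Longrightarrow> refutable \<Gamma>"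
    and refutable_T_Disj_cumulative: "T (Disj A B) \<in> \<Gamma> \<Longrightarrow>
      refutable (\<Gamma> \<union> {T A}) \<Longrightarrow> refutable (\<Gamma> \<union> {T B}) \<Longrightarrow> refutable \<Gamma>"
    and refutable_F_Conj_cumulative: "F (Conj A B) \<in> \<Gamma> \<Longrightarrow>
      refutable (\<Gamma> \<union> {F A}) \<Longrightarrow> refutable (\<Gamma> \<union> {F B}) \<Longrightarrow> refutable \<Gamma>"
    and refutable_T_Impl_cumulative: "T (Impl A B) \<in> \<Gamma> \<Longrightarrow>
      refutable (\<Gamma> \<union> {F A}) \<Longrightarrow> refutable (\<Gamma> \<union> {T B}) \<Longrightarrow> refutable \<Gamma>"
proof -
  have drop: "refutable (\<Gamma> - {\<phi>} \<union> C)"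
    if "refutable (\<Gamma> \<union> C)" "\<phi> \<in> absorbed (\<Gamma> - {\<phi>} \<union> C)" for \<phi> C
  proof (rule refutable_absorb[OF that(1)])
    show "\<Gamma> \<union> C \<subseteq> absorbed (\<Gamma> - {\<phi>} \<union> C)"
      using absorbed_subset_remove[OF that(2)] by (auto intro: absorbed.base)
  qed
  show "refutable \<Gamma>" if "T (Conj A B) \<in> \<Gamma>" "refutable (\<Gamma> \<union> {T A, T B})"
    by (rule refutable_T_Conj[OF that(1)], rule drop[OF that(2)]) (simp_all add: absorbed.intros)
  show "refutable \<Gamma>" if "F (Disj A B) \<in> \<Gamma>" "refutable (\<Gamma> \<union> {F A, F B})"
    by (rule refutable_F_Disj[OF that(1)], rule drop[OF that(2)]) (simp_all add: absorbed.intros)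
  show "refutable \<Gamma>" if "T (Disj A B) \<in> \<Gamma>" "refutable (\<Gamma> \<union> {T A})" "refutable (\<Gamma> \<union> {T B})"
    by (rule refutable_T_Disj[OF that(1) drop[OF that(2)] drop[OF that(3)]])
      (simp_all add: absorbed.intros)
  show "refutable \<Gamma>" if "F (Conj A B) \<in> \<Gamma>" "refutable (\<Gamma> \<union> {F A})" "refutable (\<Gamma> \<union> {F B})"
    by (rule refutable_F_Conj[OF that(1) drop[OF that(2)] drop[OF that(3)]])
      (simp_all add: absorbed.intros)
  show "refutable \<Gamma>" if "T (Impl A B) \<in> \<Gamma>" "refutable (\<Gamma> \<union> {F A})" "refutable (\<Gamma> \<union> {T B})"
    by (rule refutable_T_Impl[OF that(1) that(2) drop[OF that(3)]]) (simp_all add: absorbed.intros)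
qed

section \<open>The model of maximal non-refutable blocks\<close>

lemma subformulae_refl: "A \<in> subformulae A"
  by (cases A) auto

lemma subformulae_trans: "B \<in> subformulae A \<Longrightarrow> subformulae B \<subseteq> subformulae A"
  by (induction A) auto

lemma finite_subformulae: "finite (subformulae A)"
  by (induction A) auto

lemma subformulae_Sub: "A \<in> Sub \<Pi> \<Longrightarrow> subformulae A \<subseteq> Sub \<Pi>"
  unfolding Sub_def using subformulae_trans[of A] by blast

lemma Sub_components:
  shows "Conj A B \<in> Sub \<Pi> \<Longrightarrow> A \<in> Sub \<Pi> \<and> B \<in> Sub \<Pi>"
    and "Disj A B \<in> Sub \<Pi> \<Longrightarrow> A \<in> Sub \<Pi> \<and> B \<in> Sub \<Pi>"
    and "Impl A B \<in> Sub \<Pi> \<Longrightarrow> A \<in> Sub \<Pi> \<and> B \<in> Sub \<Pi>"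
  using subformulae_Sub[of "Conj A B" \<Pi>] subformulae_Sub[of "Disj A B" \<Pi>]
    subformulae_Sub[of "Impl A B" \<Pi>] subformulae_refl[of A] subformulae_refl[of B]
  by auto

lemma finite_Sub:
  assumes "finite \<Pi>"
  shows "finite (Sub \<Pi>)"
proof -
  have "{A. T A \<in> \<Pi> \<or> F A \<in> \<Pi>} = T -` \<Pi> \<union> F -` \<Pi>"
    by auto
  then show ?thesis
    using assms by (auto simp: Sub_def finite_subformulae inj_def intro!: finite_vimageI)
qed

definition signed_Sub :: "'v block \<Rightarrow> 'v block" where
  "signed_Sub \<Pi> = T ` Sub \<Pi> \<union> F ` Sub \<Pi>"

lemma T_in_signed_Sub [simp]: "T A \<in> signed_Sub \<Pi> \<longleftrightarrow> A \<in> Sub \<Pi>"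
  and F_in_signed_Sub [simp]: "F A \<in> signed_Sub \<Pi> \<longleftrightarrow> A \<in> Sub \<Pi>"
  by (auto simp: signed_Sub_def)

lemma block_subset_signed_Sub: "\<Pi> \<subseteq> signed_Sub \<Pi>"
proof
  fix \<phi> assume "\<phi> \<in> \<Pi>"
  then show "\<phi> \<in> signed_Sub \<Pi>"
    by (cases \<phi>) (auto simp: Sub_def intro: subformulae_refl)
qed

lemma finite_signed_Sub: "finite \<Pi> \<Longrightarrow> finite (signed_Sub \<Pi>)"
  by (simp add: signed_Sub_def finite_Sub)

lemma card_signed_Sub: "finite \<Pi> \<Longrightarrow> card (signed_Sub \<Pi>) = 2 * card (Sub \<Pi>)"
  unfolding signed_Sub_def
  by (subst card_Un_disjoint) (auto simp: finite_Sub card_image inj_on_def)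

text \<open>Maximality is relative to the signed subformulae of \<open>\<Pi>\<close>, which keeps the blocks finite in
  number. That a maximal block contains each of these formulae with one of the two signs would
  amount to admissibility of cut; the truth lemma below gets by with the Hintikka conditions.\<close>

definition maximal_blocks :: "'v block \<Rightarrow> 'v block set" where
  "maximal_blocks \<Pi> = {\<Gamma>. \<Gamma> \<subseteq> signed_Sub \<Pi> \<and> \<not> refutable \<Gamma> \<and>
     (\<forall>\<Delta>. \<Gamma> \<subseteq> \<Delta> \<and> \<Delta> \<subseteq> signed_Sub \<Pi> \<and> \<not> refutable \<Delta> \<longrightarrow> \<Delta> = \<Gamma>)}"

lemma maximal_block_extending:
  assumes "finite \<Pi>" "\<Gamma> \<subseteq> signed_Sub \<Pi>" "\<not> refutable \<Gamma>"
  obtains \<Delta> where "\<Delta> \<in> maximal_blocks \<Pi>" "\<Gamma> \<subseteq> \<Delta>"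
proof -
  let ?X = "{\<Delta>. \<Delta> \<subseteq> signed_Sub \<Pi> \<and> \<not> refutable \<Delta>}"
  have "finite ?X"
    using finite_signed_Sub[OF assms(1)] by simp
  then obtain \<Delta> where "\<Delta> \<in> ?X" "\<Gamma> \<subseteq> \<Delta>" "\<forall>\<Theta>\<in>?X. \<Delta> \<subseteq> \<Theta> \<longrightarrow> \<Delta> = \<Theta>"
    using finite_has_maximal2[of ?X \<Gamma>] assms(2,3) by auto
  then have "\<Delta> \<in> maximal_blocks \<Pi>"
    unfolding maximal_blocks_def by blast
  then show thesis
    using that \<open>\<Gamma> \<subseteq> \<Delta>\<close> by blast
qed

lemma maximal_block_contains:
  assumes "\<Gamma> \<in> maximal_blocks \<Pi>" "C \<subseteq> signed_Sub \<Pi>" "\<not> refutable (\<Gamma> \<union> C)"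
  shows "C \<subseteq> \<Gamma>"
proof -
  have "\<Gamma> \<union> C = \<Gamma>"
    using assms unfolding maximal_blocks_def by blast
  then show ?thesis
    by blast
qed

lemma maximal_block_components:
  assumes \<Gamma>: "\<Gamma> \<in> maximal_blocks \<Pi>"
  shows "T (Conj A B) \<in> \<Gamma> \<Longrightarrow> T A \<in> \<Gamma> \<and> T B \<in> \<Gamma>"
    and "F (Conj A B) \<in> \<Gamma> \<Longrightarrow> F A \<in> \<Gamma> \<or> F B \<in> \<Gamma>"
    and "T (Disj A B) \<in> \<Gamma> \<Longrightarrow> T A \<in> \<Gamma> \<or> T B \<in> \<Gamma>"
    and "F (Disj A B) \<in> \<Gamma> \<Longrightarrow> F A \<in> \<Gamma> \<and> F B \<in> \<Gamma>"
    and "T (Impl A B) \<in> \<Gamma> \<Longrightarrow> F A \<in> \<Gamma> \<or> T B \<in> \<Gamma>"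
proof -
  have nr: "\<not> refutable \<Gamma>" and sub: "\<Gamma> \<subseteq> signed_Sub \<Pi>"
    using \<Gamma> by (auto simp: maximal_blocks_def)
  have Sub: "T C \<in> \<Gamma> \<Longrightarrow> C \<in> Sub \<Pi>" "F C \<in> \<Gamma> \<Longrightarrow> C \<in> Sub \<Pi>" for C
    using sub by auto
  note contains = maximal_block_contains[OF \<Gamma>]
  show "T A \<in> \<Gamma> \<and> T B \<in> \<Gamma>" if "T (Conj A B) \<in> \<Gamma>"
    using contains[of "{T A, T B}"] refutable_T_Conj_cumulative[OF that] nr
      Sub_components(1)[OF Sub(1)[OF that]] by auto
  show "F A \<in> \<Gamma> \<or> F B \<in> \<Gamma>" if "F (Conj A B) \<in> \<Gamma>"
    using contains[of "{F A}"] contains[of "{F B}"] refutable_F_Conj_cumulative[OF that] nr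
      Sub_components(1)[OF Sub(2)[OF that]] by auto
  show "T A \<in> \<Gamma> \<or> T B \<in> \<Gamma>" if "T (Disj A B) \<in> \<Gamma>"
    using contains[of "{T A}"] contains[of "{T B}"] refutable_T_Disj_cumulative[OF that] nr
      Sub_components(2)[OF Sub(1)[OF that]] by auto
  show "F A \<in> \<Gamma> \<and> F B \<in> \<Gamma>" if "F (Disj A B) \<in> \<Gamma>"
    using contains[of "{F A, F B}"] refutable_F_Disj_cumulative[OF that] nr
      Sub_components(2)[OF Sub(2)[OF that]] by auto
  show "F A \<in> \<Gamma> \<or> T B \<in> \<Gamma>" if "T (Impl A B) \<in> \<Gamma>"
    using contains[of "{F A}"] contains[of "{T B}"] refutable_T_Impl_cumulative[OF that] nr
      Sub_components(3)[OF Sub(1)[OF that]] by auto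
qed

lemma maximal_block_F_Impl:
  assumes "finite \<Pi>" "\<Gamma> \<in> maximal_blocks \<Pi>" "F (Impl A B) \<in> \<Gamma>"
  obtains \<Delta> where "\<Delta> \<in> maximal_blocks \<Pi>" "T_part \<Gamma> \<subseteq> T_part \<Delta>" "T A \<in> \<Delta>" "F B \<in> \<Delta>"
proof -
  have nr: "\<not> refutable \<Gamma>" and sub: "\<Gamma> \<subseteq> signed_Sub \<Pi>"
    using assms(2) by (auto simp: maximal_blocks_def)
  have "A \<in> Sub \<Pi> \<and> B \<in> Sub \<Pi>"
    using Sub_components(3)[of A B] sub assms(3) by auto
  then have "T_part \<Gamma> \<union> {T A, F B} \<subseteq> signed_Sub \<Pi>"
    using sub by (auto simp: T_part_def)
  moreover have "\<not> refutable (T_part \<Gamma> \<union> {T A, F B})"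
    using refutable_F_Impl[OF assms(3)] nr by blast
  ultimately obtain \<Delta> where "\<Delta> \<in> maximal_blocks \<Pi>" "T_part \<Gamma> \<union> {T A, F B} \<subseteq> \<Delta>"
    using maximal_block_extending[OF assms(1)] by blast
  then show thesis
    using that[of \<Delta>] by (auto simp: T_part_def)
qed

definition canonical_model :: "'v block \<Rightarrow> ('v block, 'v) kripke" where
  "canonical_model \<Pi> =
     \<lparr> worlds = maximal_blocks \<Pi>,
       acc = {(\<Gamma>, \<Delta>). \<Gamma> \<in> maximal_blocks \<Pi> \<and> \<Delta> \<in> maximal_blocks \<Pi> \<and> T_part \<Gamma> \<subseteq> T_part \<Delta>},
       val = (\<lambda>\<Gamma>. {p. T (Atom p) \<in> \<Gamma>}) \<rparr>"

lemma worlds_canonical_model [simp]: "worlds (canonical_model \<Pi>) = maximal_blocks \<Pi>"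
  by (simp add: canonical_model_def)

lemma kripke_model_canonical_model:
  assumes "maximal_blocks \<Pi> \<noteq> {}"
  shows "kripke_model (canonical_model \<Pi>)"
proof -
  have "val (canonical_model \<Pi>) \<Gamma> \<subseteq> val (canonical_model \<Pi>) \<Delta>"
    if "(\<Gamma>, \<Delta>) \<in> acc (canonical_model \<Pi>)" for \<Gamma> \<Delta>
    using that by (auto simp: canonical_model_def T_part_def)
  moreover have "preorder_on (maximal_blocks \<Pi>) (acc (canonical_model \<Pi>))"
    by (auto simp: canonical_model_def preorder_on_def refl_on_def trans_def)
  ultimately show ?thesis
    using assms by (auto simp: kripke_model_def)
qed

text \<open>Separate implications for the two signs make the induction independent of whether the block
  decides every subformula. For \<open>T (Impl A B)\<close> the formula is itself passed on
  to all later blocks by the order on \<open>T\<close>-parts, so the Hintikka condition can be used there.\<close>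

lemma canonical_model_truth:
  assumes "finite \<Pi>" "\<Gamma> \<in> maximal_blocks \<Pi>"
  shows "(T A \<in> \<Gamma> \<longrightarrow> forces (canonical_model \<Pi>) \<Gamma> A) \<and>
         (F A \<in> \<Gamma> \<longrightarrow> \<not> forces (canonical_model \<Pi>) \<Gamma> A)"
  using assms(2)
proof (induction A arbitrary: \<Gamma>)
  case (Atom p)
  then have "\<not> closed_block \<Gamma>"
    using refutable_closed[of \<Gamma>] by (auto simp: maximal_blocks_def)
  then show ?case
    by (auto simp: closed_block_def canonical_model_def)
next
  case Falsum
  then have "\<not> closed_block \<Gamma>"
    using refutable_closed[of \<Gamma>] by (auto simp: maximal_blocks_def)
  then show ?case
    by (auto simp: closed_block_def)
next
  case (Conj A B)
  then show ?case
    using maximal_block_components(1,2)[OF Conj.prems, of A B] by auto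
next
  case (Disj A B)
  then show ?case
    using maximal_block_components(3,4)[OF Disj.prems, of A B] by auto
next
  case (Impl A B)
  have "forces (canonical_model \<Pi>) \<Gamma> (Impl A B)" if "T (Impl A B) \<in> \<Gamma>"
  proof -
    have "forces (canonical_model \<Pi>) \<Delta> A \<longrightarrow> forces (canonical_model \<Pi>) \<Delta> B"
      if "\<Delta> \<in> maximal_blocks \<Pi>" "T_part \<Gamma> \<subseteq> T_part \<Delta>" for \<Delta>
    proof -
      have "T (Impl A B) \<in> \<Delta>"
        using that(2) \<open>T (Impl A B) \<in> \<Gamma>\<close> by (auto simp: T_part_def)
      then have "F A \<in> \<Delta> \<or> T B \<in> \<Delta>"
        by (rule maximal_block_components(5)[OF that(1)])
      then show ?thesis
        using Impl.IH that(1) by blast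
    qed
    then show ?thesis
      by (auto simp: canonical_model_def)
  qed
  moreover have "\<not> forces (canonical_model \<Pi>) \<Gamma> (Impl A B)" if F_Impl: "F (Impl A B) \<in> \<Gamma>"
  proof -
    obtain \<Delta> where \<Delta>: "\<Delta> \<in> maximal_blocks \<Pi>" "T_part \<Gamma> \<subseteq> T_part \<Delta>" "T A \<in> \<Delta>" "F B \<in> \<Delta>"
      by (rule maximal_block_F_Impl[OF assms(1) Impl.prems F_Impl])
    moreover have "(\<Gamma>, \<Delta>) \<in> acc (canonical_model \<Pi>)"
      using \<Delta> Impl.prems by (simp add: canonical_model_def)
    ultimately show ?thesis
      using Impl.IH by auto
  qed
  ultimately show ?case
    by blast
qed

lemma finite_card_maximal_blocks:
  assumes "finite \<Pi>"
  shows finite_maximal_blocks: "finite (maximal_blocks \<Pi>)"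
    and card_maximal_blocks: "card (maximal_blocks \<Pi>) \<le> 4 ^ card (Sub \<Pi>)"
proof -
  have sub: "maximal_blocks \<Pi> \<subseteq> Pow (signed_Sub \<Pi>)"
    by (auto simp: maximal_blocks_def)
  have fin: "finite (Pow (signed_Sub \<Pi>))"
    using finite_signed_Sub[OF assms] by simp
  show "finite (maximal_blocks \<Pi>)"
    using sub fin by (rule finite_subset)
  have "card (maximal_blocks \<Pi>) \<le> 2 ^ (2 * card (Sub \<Pi>))"
    using card_mono[OF fin sub] finite_signed_Sub[OF assms]
    by (simp add: card_Pow card_signed_Sub[OF assms])
  then show "card (maximal_blocks \<Pi>) \<le> 4 ^ card (Sub \<Pi>)"
    by (simp add: power_mult)
qed

section \<open>Changing the type of worlds\<close>

text \<open>Forcing is invariant under isomorphism. Transporting a model along an injection moves it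
  to any type with enough elements, in particular a finite model to any infinite type.\<close>

definition transport :: "('a \<Rightarrow> 'b) \<Rightarrow> ('a, 'v) kripke \<Rightarrow> ('b, 'v) kripke" where
  "transport f M =
     \<lparr> worlds = f ` worlds M,
       acc = {(f w, f v) | w v. w \<in> worlds M \<and> v \<in> worlds M \<and> (w, v) \<in> acc M},
       val = (\<lambda>x. val M (inv_into (worlds M) f x)) \<rparr>"

lemma worlds_transport [simp]: "worlds (transport f M) = f ` worlds M"
  by (simp add: transport_def)

lemma acc_transport:
  assumes "inj_on f (worlds M)" "w \<in> worlds M" "v \<in> worlds M"
  shows "(f w, f v) \<in> acc (transport f M) \<longleftrightarrow> (w, v) \<in> acc M"
  using assms by (auto simp: transport_def dest: inj_onD)

lemma val_transport:
  assumes "inj_on f (worlds M)" "w \<in> worlds M"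
  shows "val (transport f M) (f w) = val M w"
  using assms by (simp add: transport_def)

lemma forces_transport:
  assumes "inj_on f (worlds M)" "w \<in> worlds M"
  shows "forces (transport f M) (f w) A \<longleftrightarrow> forces M w A"
  using assms(2)
  by (induction A arbitrary: w) (auto simp: val_transport acc_transport assms(1))

lemma kripke_model_transport:
  assumes inj: "inj_on f (worlds M)" and M: "kripke_model M"
  shows "kripke_model (transport f M)"
proof -
  have "acc (transport f M) \<subseteq> f ` worlds M \<times> f ` worlds M"
    by (auto simp: transport_def)
  moreover have "refl_on (worlds M) (acc M)" "trans (acc M)"
    using M by (auto simp: kripke_model_def preorder_on_def)
  ultimately have "preorder_on (f ` worlds M) (acc (transport f M))"
    unfolding preorder_on_def refl_on_def trans_def
    using acc_transport[OF inj] by (smt (verit) image_iff mem_Sigma_iff subset_iff)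
  then show ?thesis
    using M by (auto simp: kripke_model_def val_transport[OF inj] acc_transport[OF inj])
qed

lemma finite_inj_into_infinite:
  assumes "finite X"
  obtains f :: "'a \<Rightarrow> 'w::infinite" where "inj_on f X"
proof -
  obtain Y :: "'w set" where "finite Y" "card Y = card X"
    using infinite_arbitrarily_large[OF infinite_UNIV, of "card X"] by blast
  then obtain f where "bij_betw f X Y"
    using finite_same_card_bij[OF assms] by metis
  then show thesis
    using that by (auto simp: bij_betw_def)
qed

section \<open>Completeness and the finite model property\<close>

lemma small_model_if_not_refutable:
  fixes \<Pi> :: "'v block"
  assumes "finite \<Pi>" "\<not> refutable \<Pi>"
  shows "\<exists>(M :: ('w::infinite, 'v) kripke) w.
    kripke_model M \<and> finite (worlds M) \<and> card (worlds M) \<le> 4 ^ card (Sub \<Pi>) \<and>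
    w \<in> worlds M \<and> realized_at M w \<Pi>"
proof -
  obtain \<Gamma> where \<Gamma>: "\<Gamma> \<in> maximal_blocks \<Pi>" "\<Pi> \<subseteq> \<Gamma>"
    using maximal_block_extending[OF assms(1) block_subset_signed_Sub assms(2)] .
  obtain f :: "'v block \<Rightarrow> 'w" where "inj_on f (maximal_blocks \<Pi>)"
    using finite_inj_into_infinite[OF finite_maximal_blocks[OF assms(1)]] .
  then have f: "inj_on f (worlds (canonical_model \<Pi>))"
    by simp
  let ?M = "transport f (canonical_model \<Pi>)"
  have "kripke_model ?M"
    using \<Gamma>(1) by (intro kripke_model_transport f kripke_model_canonical_model) auto
  moreover have "finite (worlds ?M)"
    using finite_maximal_blocks[OF assms(1)] by simp
  moreover have "card (worlds ?M) \<le> 4 ^ card (Sub \<Pi>)"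
    using card_maximal_blocks[OF assms(1)] f by (simp add: card_image)
  moreover have "f \<Gamma> \<in> worlds ?M"
    using \<Gamma>(1) by simp
  moreover have "realized_at ?M (f \<Gamma>) \<Pi>"
    using canonical_model_truth[OF assms(1) \<Gamma>(1)] \<Gamma> forces_transport[OF f]
    by (auto simp: realized_at_def)
  ultimately show ?thesis
    by blast
qed

theorem corollary5p9:
  fixes \<Pi> :: "'v::countable block"
  assumes "finite \<Pi>"
  shows "(refutable \<Pi> \<longleftrightarrow> \<not> realizable TYPE('w::infinite) \<Pi>) \<and>
         (realizable TYPE('u) \<Pi> \<longrightarrow>
           (\<exists>(M :: ('w, 'v) kripke) w.
              kripke_model M \<and> finite (worlds M) \<and> card (worlds M) \<le> 4 ^ card (Sub \<Pi>) \<and>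
              w \<in> worlds M \<and> realized_at M w \<Pi>))"
proof -
  have "\<not> realizable TYPE('w) \<Pi>" "\<not> realizable TYPE('u) \<Pi>" if "refutable \<Pi>"
    using that by (rule refutable_not_realizable)+
  moreover have "realizable TYPE('w) \<Pi>" if "\<not> refutable \<Pi>"
    using small_model_if_not_refutable[OF assms that, where 'w = 'w]
    unfolding realizable_def by blast
  ultimately show ?thesis
    using small_model_if_not_refutable[OF assms, where 'w = 'w] by blast
qed

end
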